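(* Let $\mathbf Z=(\mathbf Y,\mathbf X)$ be an ergodic unreliable Jackson network process with routing matrix $R$, and let $\mathbf Z'=(\mathbf Y',\mathbf X')$ be another unreliable Jackson network process on the same node set having the same arrival and service intensities and the same failure-repair rates, but with routing matrix $R'=[r'_{ij}]_{i,j=0,1,\dots,J}$, such that the solutions of the traffic equations derived from $R$ and from $R'$ coincide (denoted by $\eta$). Assume that both networks follow rerouting mechanisms $(R^D)_{D\subseteq\tilde J}$ and $(R'^D)_{D\subseteq\tilde J}$, respectively, satisfying the rerouting assumption. Then for arbitrary real functions $f,g\in L^2(\tilde{\mathbb E},\tilde\pi)$ $$\langle f,Q^{\mathbf Z}g\rangle_{\tilde\pi}-\langle f,Q^{\mathbf Z'}g\rangle_{\tilde\pi}=E_{\tilde\pi}\left[\frac{\lambda}{\xi^{Y_t}_0}\,\mathrm{tr}\Big(W^{g,f}(Y_t,X_t)\cdot\mathrm{diag}(\xi^{Y_t})\cdot\big(R^{Y_t}-R'^{\,Y_t}\big)\Big)\right],$$ where $\mathrm{tr}$ denotes the trace, $\xi^D$ is the probability solution of $x=x\cdot R^D$ specified in the context, and $$W^{g,f}(D,n)=\big[g(D,n+e_i)f(D,n+e_j)\big]_{i,j\in\tilde J_0\setminus D}.$$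
   Context: Notation: $\mathbb N=\{0,1,2,\dots\}$, $\tilde J=\{1,\dots,J\}$, $\tilde J_0=\{0,1,\dots,J\}$; $\subset$ denotes strict inclusion; $e_j$ is the $j$-th standard base vector of $\mathbb N^J$ ($1\le j\le J$) and $e_0=0$. $\langle f,g\rangle_{\nu}=\int fg\,d\nu$; $\mathrm{diag}(\xi)$ is the diagonal matrix with $\xi$ on the diagonal. $E_{\tilde\pi}$ is expectation when $(Y_t,X_t)$ has distribution $\tilde\pi$. Network data: an arrival intensity $\lambda>0$; an irreducible stochastic routing matrix $R=[r_{ij}]_{i,j\in\tilde J_0}$ ($r_{00}\ge 0$ allowed; node $0$ is source and sink); service rates $\mu_j(k)>0$ for $k\ge1$, $\mu_j(0)=0$, with $\sup_{j,k}\mu_j(k)<\infty$. The traffic equations $\eta_j=\lambda r_{0j}+\sum_{i=1}^J\eta_ir_{ij}$, $j\in\tilde J$, have a unique solution $(\eta_j)_{j\in\tilde J}$; put $\eta_0=\lambda$. The network (without breakdowns) is assumed ergodic, i.e. $C_j:=\sum_{m\ge0}\prod_{k=1}^{m}\eta_j/\mu_j(k)<\infty$ for all $j$, and $\pi(n)=\prod_{j=1}^J C_j^{-1}\prod_{k=1}^{n_j}\frac{\eta_j}{\mu_j(k)}$ on $\mathbb N^J$. Breakdown and repair: functions $A,B:2^{\tilde J}\to[0,\infty)$ with $A(\emptyset)=B(\emptyset)=1$, $A(I)/A(D)<\infty$ for all $D\subset I\subseteq\tilde J$ and $B(D)/B(H)<\infty$ for all $H\subset D\subseteq\tilde J$ (conventions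 $0/0=0$, $1/0=\infty$). $\mathbf Y$ is the Markov process on $2^{\tilde J}$ (its state is the set of broken down nodes) with rates (failure-repair rates) $q^{\mathbf Y}(D,I)=A(I)/A(D)$ for $D\subset I$, $q^{\mathbf Y}(D,H)=B(D)/B(H)$ for $H\subset D$, other off-diagonal rates zero, and generator $(Q^{\mathbf Y}h)(D)=\sum_{H\subset D}q^{\mathbf Y}(D,H)(h(H)-h(D))+\sum_{I\supset D}q^{\mathbf Y}(D,I)(h(I)-h(D))$. It is reversible with respect to the probability $\hat\pi(D)=\hat C^{-1}A(D)/B(D)$. Rerouting assumption (for a network with routing $R$ and traffic solution $\eta$): for each $D\subseteq\tilde J$ there is a stochastic matrix $R^D=[r^D_{ij}]_{i,j\in\tilde J_0\setminus D}$, $R^\emptyset=R$, such that $\eta_j=\lambda r^D_{0j}+\sum_{i\in\tilde J\setminus D}\eta_ir^D_{ij}$ for all $j\in\tilde J\setminus D$ (same $\eta$ for every $D$). Then $(\eta_j)_{j\in\tilde J_0\setminus D}$ solves $x=x\cdot R^D$, and $\xi^D=(\xi^D_j)_{j\in\tilde J_0\setminus D}$ denotes its normalization to a probability vector, $\xi^D_j=\eta_j/\sum_{k\in\tilde J_0\setminus D}\eta_k$. Unreliable Jackson network process $\mathbf Z=(\mathbf Y,\mathbf X)$: the Markov process on $\tilde{\mathbb E}=2^{\tilde J}\times\mathbb N^J$ with generator $(Q^{\mathbf Z}f)(D,n)=\sum_{j\in\tilde J\setminus D}\lambda r^D_{0j}(f(D,n+e_j)-f(D,n))+\sum_{j\in\tilde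 J\setminus D}\mu_j(n_j)r^D_{j0}(f(D,n-e_j)-f(D,n))+\sum_{j\in\tilde J\setminus D}\mu_j(n_j)\sum_{i\in\tilde J\setminus D}r^D_{ji}(f(D,n-e_j+e_i)-f(D,n))+(Q^{\mathbf Y}f(\cdot,n))(D)$. Terms with factor $\mu_j(0)$ are zero. If $\mathbf Z$ is ergodic, its unique stationary distribution is known to be $\tilde\pi(D,n)=\hat\pi(D)\pi(n)$. The process $\mathbf Z'$ is built in the same way from the same $\lambda,\mu_j,A,B$ with $R'$ and $(R'^D)$ in place of $R$ and $(R^D)$. *)

theory Defs
  imports "HOL-Probability.Probability"
begin

(* The node set {1..J} is a finite type 'j, so J = CARD('j). The set {0..J} is
   'j option, where None is node 0 (source and sink) and Some j is node j.
   A network state (D, n) consists of the set D of broken down nodes and the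
   vector n of queue lengths. *)

type_synonym 'j state = "'j set \<times> (nat ^ 'j)"

type_synonym 'j routing = "'j option \<Rightarrow> 'j option \<Rightarrow> real"

(* The index set {0..J} - D. *)
definition up_nodes :: "'j set \<Rightarrow> 'j option set"
  where "up_nodes D = - Some ` D"

definition base_vec :: "'j::finite option \<Rightarrow> nat ^ 'j"
  where "base_vec i = (case i of None \<Rightarrow> 0 | Some j \<Rightarrow> axis j 1)"


section \<open>Matrices indexed by a finite set\<close>

definition stochastic_on :: "'i set \<Rightarrow> ('i \<Rightarrow> 'i \<Rightarrow> real) \<Rightarrow> bool"
  where "stochastic_on S M \<longleftrightarrow> (\<forall>i\<in>S. (\<forall>j\<in>S. 0 \<le> M i j) \<and> (\<Sum>j\<in>S. M i j) = 1)"

definition irreducible_matrix :: "('i \<Rightarrow> 'i \<Rightarrow> real) \<Rightarrow> bool"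
  where "irreducible_matrix M \<longleftrightarrow> (\<forall>i j. (i, j) \<in> {(k, l). M k l > 0}\<^sup>*)"

definition mat_mult_on ::
    "'i set \<Rightarrow> ('i \<Rightarrow> 'i \<Rightarrow> real) \<Rightarrow> ('i \<Rightarrow> 'i \<Rightarrow> real) \<Rightarrow> 'i \<Rightarrow> 'i \<Rightarrow> real"
  where "mat_mult_on S M N i j = (\<Sum>k\<in>S. M i k * N k j)"

definition diag_mat :: "('i \<Rightarrow> real) \<Rightarrow> 'i \<Rightarrow> 'i \<Rightarrow> real"
  where "diag_mat v i j = (if i = j then v i else 0)"

definition mat_diff :: "('i \<Rightarrow> 'i \<Rightarrow> real) \<Rightarrow> ('i \<Rightarrow> 'i \<Rightarrow> real) \<Rightarrow> 'i \<Rightarrow> 'i \<Rightarrow> real"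
  where "mat_diff M N i j = M i j - N i j"

definition trace_on :: "'i set \<Rightarrow> ('i \<Rightarrow> 'i \<Rightarrow> real) \<Rightarrow> real"
  where "trace_on S M = (\<Sum>i\<in>S. M i i)"


section \<open>Square integrable functions\<close>

definition L2 :: "'s measure \<Rightarrow> ('s \<Rightarrow> real) set"
  where "L2 M = {f \<in> borel_measurable M. integrable M (\<lambda>x. (f x)\<^sup>2)}"

definition L2_inner :: "'s measure \<Rightarrow> ('s \<Rightarrow> real) \<Rightarrow> ('s \<Rightarrow> real) \<Rightarrow> real"
  where "L2_inner M f g = (\<integral>x. f x * g x \<partial>M)"


section \<open>Ergodic Markov processes on a countable state space\<close>

(* G is a generator acting on functions, so G (indicator {y}) x is the entry
   q(x, y) of the intensity matrix (also for x = y). For bounded intensities,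
   as below, the transition semigroup P is determined by G. *)
definition transition_semigroup ::
    "(('s \<Rightarrow> real) \<Rightarrow> 's \<Rightarrow> real) \<Rightarrow> (real \<Rightarrow> 's \<Rightarrow> 's pmf) \<Rightarrow> bool"
  where "transition_semigroup G P \<longleftrightarrow>
    (\<forall>x. P 0 x = return_pmf x) \<and>
    (\<forall>s\<ge>0. \<forall>t\<ge>0. \<forall>x. P (s + t) x = bind_pmf (P s x) (P t)) \<and>
    (\<forall>x y. ((\<lambda>t. pmf (P t x) y) has_real_derivative G (indicator {y}) x) (at 0 within {0..}))"

(* Transient states are allowed: A D = 0 makes the states (D, n) transient. *)
definition ergodic_process :: "(('s \<Rightarrow> real) \<Rightarrow> 's \<Rightarrow> real) \<Rightarrow> bool"
  where "ergodic_process G \<longleftrightarrow>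
    (\<exists>P p. transition_semigroup G P \<and>
       (\<forall>x y. ((\<lambda>t. pmf (P t x) y) \<longlongrightarrow> pmf p y) at_top))"


section \<open>Jackson networks\<close>

(* The traffic equations on the nodes outside D, for the arrival intensity lam. *)
definition traffic_equations ::
    "real \<Rightarrow> 'j::finite set \<Rightarrow> 'j routing \<Rightarrow> ('j \<Rightarrow> real) \<Rightarrow> bool"
  where "traffic_equations lam D R \<eta> \<longleftrightarrow>
    (\<forall>j\<in>-D. \<eta> j = lam * R None (Some j) + (\<Sum>i\<in>-D. \<eta> i * R (Some i) (Some j)))"

definition queue_weight :: "('j \<Rightarrow> nat \<Rightarrow> real) \<Rightarrow> ('j \<Rightarrow> real) \<Rightarrow> 'j \<Rightarrow> nat \<Rightarrow> real"
  where "queue_weight \<mu> \<eta> j m = (\<Prod>k=1..m. \<eta> j / \<mu> j k)"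

definition queue_const :: "('j \<Rightarrow> nat \<Rightarrow> real) \<Rightarrow> ('j \<Rightarrow> real) \<Rightarrow> 'j \<Rightarrow> real"
  where "queue_const \<mu> \<eta> j = (\<Sum>m. queue_weight \<mu> \<eta> j m)"

definition queue_dist :: "('j::finite \<Rightarrow> nat \<Rightarrow> real) \<Rightarrow> ('j \<Rightarrow> real) \<Rightarrow> nat ^ 'j \<Rightarrow> real"
  where "queue_dist \<mu> \<eta> n =
    (\<Prod>j\<in>UNIV. inverse (queue_const \<mu> \<eta> j) * queue_weight \<mu> \<eta> j (n $ j))"

locale jackson_network =
  fixes lam :: real
    and \<mu> :: "'j::finite \<Rightarrow> nat \<Rightarrow> real"
    and \<eta> :: "'j \<Rightarrow> real"
    and R :: "'j routing"
  assumes lam_pos: "lam > 0"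
    and routing_stochastic: "stochastic_on UNIV R"
    and routing_irreducible: "irreducible_matrix R"
    and service_pos: "k \<ge> 1 \<Longrightarrow> \<mu> j k > 0"
    and service_0: "\<mu> j 0 = 0"
    and service_bounded: "bdd_above (range (\<lambda>(j, k). \<mu> j k))"
    and traffic: "traffic_equations lam {} R \<eta>"
    and queue_summable: "summable (queue_weight \<mu> \<eta> j)"


section \<open>Breakdowns, repairs and rerouting\<close>

(* Division by zero yields 0, as in the convention 0/0 = 0. The convention
   1/0 = \<infinity> enters only through the finiteness of the quotients A I / A D,
   B D / B H and, for the stationary distribution, A D / B D. *)
locale failure_repair =
  fixes A B :: "'j::finite set \<Rightarrow> real"
  assumes A_nonneg: "A D \<ge> 0" and B_nonneg: "B D \<ge> 0"
    and A_empty: "A {} = 1" and B_empty: "B {} = 1"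
    and failure_rate_finite: "D \<subset> I \<Longrightarrow> A D = 0 \<Longrightarrow> A I = 0"
    and repair_rate_finite: "H \<subset> D \<Longrightarrow> B H = 0 \<Longrightarrow> B D = 0"
    and availability_weight_finite: "B D = 0 \<Longrightarrow> A D = 0"

definition availability_generator ::
    "('j::finite set \<Rightarrow> real) \<Rightarrow> ('j set \<Rightarrow> real) \<Rightarrow> ('j set \<Rightarrow> real) \<Rightarrow> 'j set \<Rightarrow> real"
  where "availability_generator A B h D =
    (\<Sum>H | H \<subset> D. B D / B H * (h H - h D)) + (\<Sum>I | D \<subset> I. A I / A D * (h I - h D))"

definition availability_dist ::
    "('j::finite set \<Rightarrow> real) \<Rightarrow> ('j set \<Rightarrow> real) \<Rightarrow> 'j set \<Rightarrow> real"
  where "availability_dist A B D = inverse (\<Sum>I\<in>UNIV. A I / B I) * (A D / B D)"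

(* Only the entries of RD D with indices in up_nodes D are meaningful. *)
locale unreliable_jackson_network =
  jackson_network lam \<mu> \<eta> R + failure_repair A B
  for lam :: real
    and \<mu> :: "'j::finite \<Rightarrow> nat \<Rightarrow> real"
    and \<eta> :: "'j \<Rightarrow> real"
    and A B :: "'j set \<Rightarrow> real"
    and R :: "'j routing" +
  fixes RD :: "'j set \<Rightarrow> 'j routing"
  assumes rerouting_empty: "RD {} = R"
    and rerouting_stochastic: "stochastic_on (up_nodes D) (RD D)"
    and rerouting_traffic: "traffic_equations lam D (RD D) \<eta>"

definition routing_dist ::
    "real \<Rightarrow> ('j::finite \<Rightarrow> real) \<Rightarrow> 'j set \<Rightarrow> 'j option \<Rightarrow> real"
  where "routing_dist lam \<eta> D i =
    case_option lam \<eta> i / (\<Sum>k\<in>up_nodes D. case_option lam \<eta> k)"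

(* Subtraction of a base vector truncates where a queue is empty, but there the
   factor \<mu> j 0 = 0 makes the term vanish. *)
definition network_generator ::
    "real \<Rightarrow> ('j::finite \<Rightarrow> nat \<Rightarrow> real) \<Rightarrow> ('j set \<Rightarrow> real) \<Rightarrow> ('j set \<Rightarrow> real) \<Rightarrow>
     ('j set \<Rightarrow> 'j routing) \<Rightarrow> ('j state \<Rightarrow> real) \<Rightarrow> 'j state \<Rightarrow> real"
  where "network_generator lam \<mu> A B RD f = (\<lambda>(D, n).
      (\<Sum>j\<in>-D. lam * RD D None (Some j) * (f (D, n + base_vec (Some j)) - f (D, n)))
    + (\<Sum>j\<in>-D. \<mu> j (n $ j) * RD D (Some j) None * (f (D, n - base_vec (Some j)) - f (D, n)))
    + (\<Sum>j\<in>-D. \<mu> j (n $ j) * (\<Sum>i\<in>-D. RD D (Some j) (Some i) *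
          (f (D, n - base_vec (Some j) + base_vec (Some i)) - f (D, n))))
    + availability_generator A B (\<lambda>H. f (H, n)) D)"

definition network_dist ::
    "('j::finite \<Rightarrow> nat \<Rightarrow> real) \<Rightarrow> ('j \<Rightarrow> real) \<Rightarrow> ('j set \<Rightarrow> real) \<Rightarrow> ('j set \<Rightarrow> real) \<Rightarrow>
     'j state measure"
  where "network_dist \<mu> \<eta> A B =
    point_measure UNIV (\<lambda>(D, n). ennreal (availability_dist A B D * queue_dist \<mu> \<eta> n))"

definition W_matrix ::
    "('j::finite state \<Rightarrow> real) \<Rightarrow> ('j state \<Rightarrow> real) \<Rightarrow> 'j set \<Rightarrow> nat ^ 'j \<Rightarrow>
     'j option \<Rightarrow> 'j option \<Rightarrow> real"
  where "W_matrix g f D n i j = g (D, n + base_vec i) * f (D, n + base_vec j)"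

(* The matrix product and the trace range over up_nodes D. *)
definition trace_term ::
    "real \<Rightarrow> ('j::finite \<Rightarrow> real) \<Rightarrow> ('j set \<Rightarrow> 'j routing) \<Rightarrow> ('j set \<Rightarrow> 'j routing) \<Rightarrow>
     ('j state \<Rightarrow> real) \<Rightarrow> ('j state \<Rightarrow> real) \<Rightarrow> 'j state \<Rightarrow> real"
  where "trace_term lam \<eta> RD RD' g f = (\<lambda>(D, n).
    lam / routing_dist lam \<eta> D None *
      trace_on (up_nodes D)
        (mat_mult_on (up_nodes D)
          (mat_mult_on (up_nodes D) (W_matrix g f D n) (diag_mat (routing_dist lam \<eta> D)))
          (mat_diff (RD D) (RD' D))))"

end

theory Submission
  imports Defs
begin

text \<open>
For each set \<open>D\<close> of broken down nodes, the network is an ordinary Jackson network on the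
remaining nodes. If node \<open>0\<close> is treated as a node that works at the constant rate \<open>lam\<close>, the
generator has the symmetric form
\<open>\<Sum>j. rate j n * \<Sum>i. RD D j i * (g (D, n - e j + e i) - g (D, n))\<close>
plus the breakdown and repair part. In the difference of two generators with the same \<open>lam\<close>,
\<open>\<mu>\<close>, \<open>A\<close> and \<open>B\<close>, the breakdown and repair parts cancel, and so do the terms with \<open>g (D, n)\<close>,
because both routing matrices have row sums one. Only the terms
\<open>rate j n * (RD D j i - RD' D j i) * f (D, n) * g (D, n - e j + e i)\<close> are left.

The product form of the stationary distribution says that the probability flow out of node
\<open>j\<close> in state \<open>n + e j\<close> is the probability of \<open>n\<close> times the throughput of \<open>j\<close>
(\<open>weight_add_job\<close>). Substituting \<open>n + e j\<close> for \<open>n\<close> in the stationary integral therefore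
replaces the rate by the throughput and the product of \<open>f\<close> and \<open>g\<close> by
\<open>f (D, n + e j) * g (D, n + e i)\<close> (\<open>integral_departure_eq_arrival\<close>). This is the entry of
\<open>W_matrix\<close> in the trace (\<open>trace_term_eq\<close>): the normalizing constant of the routing
distribution cancels against the factor in front of the trace, which leaves the throughputs.

It remains to justify that every sum converges, so that integrals may be taken term by term.
All terms have the form \<open>f s * c s * g (T s)\<close> for a bounded rate \<open>c\<close> of a transition \<open>T\<close>
which is injective where \<open>c\<close> does not vanish, and \<open>integrable_transition\<close> bounds them by the
squares of \<open>f\<close> and \<open>g\<close>, provided the stationary flow along \<open>T\<close> into a state is at most a
constant times the weight of that state. For the jumps of jobs this needs throughputs that are
strictly positive, which follows from the irreducibility of the routing matrix
(\<open>throughput_pos\<close>); for breakdowns and repairs it is detailed balance.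
\<close>

section \<open>Functions on a weighted discrete space\<close>

lemma point_measure_integral:
  fixes w F :: "'s \<Rightarrow> real"
  assumes w: "\<And>s. 0 \<le> w s"
  shows integrable_point_measure_iff_summable_on:
      "integrable (point_measure UNIV (\<lambda>s. ennreal (w s))) F
        \<longleftrightarrow> (\<lambda>s. w s * F s) summable_on UNIV" (is ?iff)
    and integral_point_measure_eq_infsum:
      "(\<integral>s. F s \<partial>point_measure UNIV (\<lambda>s. ennreal (w s))) = (\<Sum>\<^sub>\<infinity>s. w s * F s)" (is ?eq)
proof -
  have int: "integrable (point_measure UNIV (\<lambda>s. ennreal (w s))) F
      \<longleftrightarrow> integrable (count_space UNIV) (\<lambda>s. w s * F s)"
    unfolding point_measure_def by (subst integrable_density) (simp_all add: w)
  also have "\<dots> \<longleftrightarrow> (\<lambda>s. w s * F s) summable_on UNIV"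
    unfolding Infinite_Set_Sum.abs_summable_on_def[symmetric] abs_summable_equivalent[symmetric]
    by (rule summable_on_iff_abs_summable_on_real[symmetric])
  finally show iff: ?iff .
  have eq: "(\<integral>s. F s \<partial>point_measure UNIV (\<lambda>s. ennreal (w s)))
      = (\<integral>s. w s * F s \<partial>count_space UNIV)"
    unfolding point_measure_def by (subst integral_density) (simp_all add: w)
  show ?eq
  proof (cases "(\<lambda>s. w s * F s) summable_on UNIV")
    case True
    then have "Infinite_Set_Sum.abs_summable_on (\<lambda>s. w s * F s) UNIV"
      unfolding abs_summable_equivalent[symmetric] by (subst (asm) summable_on_iff_abs_summable_on_real)
    then show ?thesis
      using eq infsetsum_infsum[of "\<lambda>s. w s * F s" UNIV] by (simp add: infsetsum_def)
  next
    case False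
    then show ?thesis
      using iff by (simp add: not_integrable_integral_eq infsum_not_exists)
  qed
qed

text \<open>The change of the weight along \<open>T\<close> is controlled by the hypothesis on the flow, so that
\<open>w s * \<bar>c s\<bar> * (g (T s))\<^sup>2\<close> is at most a multiple of \<open>w * g\<^sup>2\<close> at \<open>T s\<close>, and by
injectivity every state is counted at most once. The product \<open>f s * g (T s)\<close> is
dominated by the sum of squares.\<close>

lemma integrable_transition:
  fixes w c f g :: "'s \<Rightarrow> real" and T :: "'s \<Rightarrow> 's"
  defines "M \<equiv> point_measure UNIV (\<lambda>s. ennreal (w s))"
  assumes w: "\<And>s. 0 \<le> w s"
    and f: "f \<in> L2 M" and g: "g \<in> L2 M"
    and inj: "inj_on T U"
    and outside: "\<And>s. s \<notin> U \<Longrightarrow> c s = 0"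
    and bounded: "\<And>s. \<bar>c s\<bar> \<le> C"
    and flow: "\<And>s. s \<in> U \<Longrightarrow> w s * \<bar>c s\<bar> \<le> C' * w (T s)"
  shows "integrable M (\<lambda>s. f s * (c s * g (T s)))"
proof -
  have f2: "(\<lambda>s. w s * (f s)\<^sup>2) summable_on UNIV" and g2: "(\<lambda>s. w s * (g s)\<^sup>2) summable_on UNIV"
    using f g by (auto simp: L2_def M_def integrable_point_measure_iff_summable_on[of w, OF w])
  have "(\<lambda>s. w s * (g s)\<^sup>2) summable_on T ` U"
    using g2 by (rule summable_on_subset_banach) simp
  then have "(\<lambda>s. w (T s) * (g (T s))\<^sup>2) summable_on U"
    by (simp add: summable_on_reindex[OF inj] o_def)
  then have "(\<lambda>s. C' * (w (T s) * (g (T s))\<^sup>2)) summable_on U"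
    by (rule summable_on_cmult_right)
  then have Tg: "(\<lambda>s. if s \<in> U then C' * (w (T s) * (g (T s))\<^sup>2) else 0) summable_on UNIV"
    by (rule summable_on_cong_neutral[THEN iffD1, rotated -1]) auto
  have bound: "norm (w s * (f s * (c s * g (T s)))) \<le>
      C * (w s * (f s)\<^sup>2) + (if s \<in> U then C' * (w (T s) * (g (T s))\<^sup>2) else 0)" for s
  proof (cases "s \<in> U")
    case True
    have "2 * (\<bar>f s\<bar> * \<bar>g (T s)\<bar>) \<le> (f s)\<^sup>2 + (g (T s))\<^sup>2"
      using sum_squares_bound[of "\<bar>f s\<bar>" "\<bar>g (T s)\<bar>"] by simp
    moreover have "0 \<le> \<bar>f s\<bar> * \<bar>g (T s)\<bar>" by simp
    ultimately have "\<bar>f s\<bar> * \<bar>g (T s)\<bar> \<le> (f s)\<^sup>2 + (g (T s))\<^sup>2" by linarith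
    then have "(w s * \<bar>c s\<bar>) * (\<bar>f s\<bar> * \<bar>g (T s)\<bar>) \<le> (w s * \<bar>c s\<bar>) * ((f s)\<^sup>2 + (g (T s))\<^sup>2)"
      by (intro mult_left_mono) (simp_all add: w)
    also have "\<dots> = w s * \<bar>c s\<bar> * (f s)\<^sup>2 + w s * \<bar>c s\<bar> * (g (T s))\<^sup>2"
      by (simp add: algebra_simps)
    also have "\<dots> \<le> w s * C * (f s)\<^sup>2 + C' * w (T s) * (g (T s))\<^sup>2"
      using flow[OF True] by (intro add_mono mult_right_mono mult_left_mono bounded w) simp_all
    finally show ?thesis
      using True by (simp add: abs_mult w algebra_simps)
  next
    case False
    have "0 \<le> C" using bounded[of s] by linarith
    then show ?thesis using False outside[OF False] by (simp add: w)
  qed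
  have "(\<lambda>s. norm (w s * (f s * (c s * g (T s))))) summable_on UNIV"
    by (rule Infinite_Sum.abs_summable_on_comparison_test'[OF summable_on_add[OF summable_on_cmult_right[OF f2] Tg] bound])
  then show ?thesis
    unfolding M_def integrable_point_measure_iff_summable_on[of w, OF w]
    by (subst summable_on_iff_abs_summable_on_real)
qed

section \<open>Positivity of the traffic solution\<close>

text \<open>Mass at \<open>k\<close> is passed on to every \<open>l\<close> with \<open>M k l > 0\<close>, hence along any path from \<open>a\<close> to \<open>b\<close>.\<close>

lemma irreducible_invariant_pos:
  fixes v :: "'i::finite \<Rightarrow> real"
  assumes irr: "irreducible_matrix M" and nonneg: "\<And>i j. 0 \<le> M i j"
    and v: "\<And>i. 0 \<le> v i" and inv: "\<And>j. v j = (\<Sum>i\<in>UNIV. v i * M i j)"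
    and a: "0 < v a"
  shows "0 < v b"
proof -
  have "(a, b) \<in> {(k, l). M k l > 0}\<^sup>*"
    using irr by (simp add: irreducible_matrix_def)
  then show ?thesis
  proof (induction rule: rtrancl_induct)
    case base
    show ?case by (rule a)
  next
    case (step k l)
    then have "0 < v k * M k l" by simp
    also have "\<dots> \<le> (\<Sum>i\<in>UNIV. v i * M i l)"
      by (rule member_le_sum) (simp_all add: v nonneg)
    also have "\<dots> = v l" by (rule inv[symmetric])
    finally show ?case .
  qed
qed

text \<open>An invariant vector of a stochastic matrix has an invariant absolute value: the triangle
inequality \<open>\<bar>v\<bar> \<le> \<bar>v\<bar> M\<close> holds in each entry, and both sides have the same total. So twice the
negative part, \<open>\<bar>v\<bar> - v\<close>, is a nonnegative invariant vector. It vanishes at \<open>a\<close>, so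
by irreducibility it vanishes everywhere.\<close>

lemma irreducible_stochastic_invariant_pos:
  fixes v :: "'i::finite \<Rightarrow> real"
  assumes irr: "irreducible_matrix M" and stoch: "stochastic_on UNIV M"
    and inv: "\<And>j. v j = (\<Sum>i\<in>UNIV. v i * M i j)"
    and a: "0 < v a"
  shows "0 < v b"
proof -
  have nonneg: "0 \<le> M i j" and row: "(\<Sum>j\<in>UNIV. M i j) = 1" for i j
    using stoch by (simp_all add: stochastic_on_def)
  have le: "\<bar>v j\<bar> \<le> (\<Sum>i\<in>UNIV. \<bar>v i\<bar> * M i j)" for j
    using sum_abs[of "\<lambda>i. v i * M i j" UNIV] inv[of j] by (simp add: abs_mult nonneg)
  have "(\<Sum>j\<in>UNIV. \<Sum>i\<in>UNIV. \<bar>v i\<bar> * M i j) = (\<Sum>j\<in>UNIV. \<bar>v j\<bar>)"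
    by (subst sum.swap) (simp add: row flip: sum_distrib_left)
  then have abs_inv: "\<bar>v j\<bar> = (\<Sum>i\<in>UNIV. \<bar>v i\<bar> * M i j)" for j
    by (rule sum_mono_inv[OF sym]) (simp_all add: le)
  have neg_inv: "\<bar>v j\<bar> - v j = (\<Sum>i\<in>UNIV. (\<bar>v i\<bar> - v i) * M i j)" for j
    unfolding left_diff_distrib sum_subtractf abs_inv[symmetric] inv[symmetric] ..
  (* A positive entry of the negative part would make its entry at a positive. *)
  have "0 \<le> v j" for j
    using irreducible_invariant_pos[OF irr nonneg _ neg_inv, of j a] a abs_ge_self by (cases "0 \<le> v j") auto
  then show ?thesis
    by (rule irreducible_invariant_pos[OF irr nonneg _ inv a])
qed

lemma sum_up_nodes:
  fixes h :: "'j::finite option \<Rightarrow> 'b::comm_monoid_add"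
  shows "(\<Sum>i\<in>up_nodes D. h i) = h None + (\<Sum>j\<in>-D. h (Some j))"
proof -
  have "up_nodes D = insert None (Some ` (- D))"
    by (rule set_eqI, case_tac x) (auto simp: up_nodes_def)
  then show ?thesis
    by (simp add: sum.reindex)
qed

lemma up_nodes_empty: "up_nodes {} = UNIV"
  by (simp add: up_nodes_def)

context jackson_network
begin

definition throughput :: "'j option \<Rightarrow> real"
  where "throughput = case_option lam \<eta>"

text \<open>The traffic equations say that the throughput vector is invariant under \<open>R\<close> at the nodes
other than \<open>0\<close>. Summing over all nodes gives the missing equation at node \<open>0\<close>, where the entry is
\<open>lam > 0\<close>.\<close>

lemma throughput_pos: "0 < throughput i"
proof (rule irreducible_stochastic_invariant_pos[OF routing_irreducible routing_stochastic])
  show "0 < throughput None" by (simp add: throughput_def lam_pos)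
  let ?x = throughput
  let ?y = "\<lambda>j. \<Sum>i\<in>UNIV. ?x i * R i j"
  have expand: "(\<Sum>i\<in>UNIV. h i) = h None + (\<Sum>j\<in>UNIV. h (Some j))"
    for h :: "'j option \<Rightarrow> real"
    using sum_up_nodes[of h "{}"] by (simp add: up_nodes_empty)
  have Some: "?x (Some j) = ?y (Some j)" for j
  proof -
    have "?y (Some j) = lam * R None (Some j) + (\<Sum>i\<in>-{}. \<eta> i * R (Some i) (Some j))"
      by (simp add: expand throughput_def)
    also have "\<dots> = \<eta> j"
      by (rule traffic[unfolded traffic_equations_def, rule_format, symmetric]) simp
    finally show ?thesis by (simp add: throughput_def)
  qed
  have "(\<Sum>j\<in>UNIV. ?y j) = (\<Sum>j\<in>UNIV. ?x j)"
    using routing_stochastic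
    by (subst sum.swap) (simp add: stochastic_on_def flip: sum_distrib_left)
  then have "?x None + (\<Sum>j\<in>UNIV. ?x (Some j)) = ?y None + (\<Sum>j\<in>UNIV. ?y (Some j))"
    unfolding expand[of ?x] expand[of ?y] by (rule sym)
  moreover have "(\<Sum>j\<in>UNIV. ?x (Some j)) = (\<Sum>j\<in>UNIV. ?y (Some j))"
    by (rule sum.cong[OF refl Some])
  ultimately have None: "?x None = ?y None" by linarith
  show "?x j = ?y j" for j
    by (cases j) (simp_all only: None[symmetric] Some[symmetric])
qed

section \<open>Flow through the nodes\<close>

text \<open>Arrivals from outside count as departures from node \<open>0\<close>, which always works at rate \<open>lam\<close>.\<close>

definition node_rate :: "'j option \<Rightarrow> nat ^ 'j \<Rightarrow> real"
  where "node_rate i n = (case i of None \<Rightarrow> lam | Some j \<Rightarrow> \<mu> j (n $ j))"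

lemma service_nonneg: "0 \<le> \<mu> j k"
  using service_pos[of k j] service_0[of j] by (cases "k = 0") (auto simp: less_imp_le)

lemma node_rate_nonneg: "0 \<le> node_rate i n"
  using lam_pos service_nonneg by (auto simp: node_rate_def split: option.split)

lemma node_rate_bounded:
  obtains K where "\<And>i n. node_rate i n \<le> K"
proof -
  obtain K where K: "\<forall>x\<in>range (\<lambda>(j, k). \<mu> j k). x \<le> K"
    using service_bounded unfolding bdd_above_def by blast
  have "\<mu> j k \<le> K" for j k
    using K range_eqI[of "\<mu> j k" "\<lambda>(j, k). \<mu> j k" "(j, k)"] by simp
  then have "node_rate i n \<le> max lam K" for i n
    by (cases i) (simp_all add: node_rate_def le_max_iff_disj)
  then show thesis by (rule that)
qed

lemma queue_weight_nonneg: "0 \<le> queue_weight \<mu> \<eta> j m"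
  using throughput_pos[of "Some j"] unfolding queue_weight_def throughput_def
  by (intro prod_nonneg ballI divide_nonneg_nonneg service_nonneg) simp

lemma queue_dist_nonneg: "0 \<le> queue_dist \<mu> \<eta> n"
  unfolding queue_dist_def queue_const_def
  by (intro prod_nonneg mult_nonneg_nonneg ballI queue_weight_nonneg
      inverse_nonnegative_iff_nonnegative[THEN iffD2] suminf_nonneg queue_summable)

text \<open>Adding a job at node \<open>j\<close> multiplies the weight of its queue by \<open>\<eta> j / \<mu> j (n $ j + 1)\<close>, and
the service rate cancels the denominator.\<close>

lemma queue_dist_flow:
  "queue_dist \<mu> \<eta> (n + base_vec i) * node_rate i (n + base_vec i) = queue_dist \<mu> \<eta> n * throughput i"
proof (cases i)
  case None
  then show ?thesis by (simp add: base_vec_def node_rate_def throughput_def)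
next
  case (Some j)
  let ?h = "\<lambda>n k. inverse (queue_const \<mu> \<eta> k) * queue_weight \<mu> \<eta> k (n $ k)"
  let ?n = "n + base_vec i"
  let ?P = "\<Prod>k\<in>UNIV - {j}. ?h n k"
  have split: "queue_dist \<mu> \<eta> ?n = ?h ?n j * (\<Prod>k\<in>UNIV - {j}. ?h ?n k)"
    unfolding queue_dist_def by (rule prod.remove) auto
  have rest: "(\<Prod>k\<in>UNIV - {j}. ?h ?n k) = ?P"
    by (rule prod.cong) (auto simp: Some base_vec_def axis_def)
  have "queue_dist \<mu> \<eta> ?n * node_rate i ?n = (?h ?n j * node_rate i ?n) * ?P"
    unfolding split rest by (simp only: mult_ac)
  also have "?h ?n j * node_rate i ?n = ?h n j * throughput i"
    using service_pos[of "Suc (n $ j)" j]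
    by (simp add: Some base_vec_def node_rate_def throughput_def queue_weight_def)
  also have "?h n j * throughput i * ?P = (?h n j * ?P) * throughput i"
    by (simp only: mult_ac)
  also have "?h n j * ?P = queue_dist \<mu> \<eta> n"
    unfolding queue_dist_def by (rule prod.remove[symmetric]) auto
  finally show ?thesis .
qed

end

definition add_job :: "'j::finite option \<Rightarrow> 'j state \<Rightarrow> 'j state"
  where "add_job i s = (fst s, snd s + base_vec i)"

definition move_job :: "'j::finite option \<Rightarrow> 'j option \<Rightarrow> 'j state \<Rightarrow> 'j state"
  where "move_job j i s = (fst s, snd s - base_vec j + base_vec i)"

lemma move_job_add_job [simp]: "move_job j i (add_job j s) = add_job i s"
  by (simp add: move_job_def add_job_def)

lemma inj_add_job: "inj (add_job i)"
  by (auto simp: inj_def add_job_def prod_eq_iff)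

lemma inj_on_move_job: "inj_on (move_job j i) (range (add_job j))"
proof (rule inj_onI)
  fix s t
  assume "s \<in> range (add_job j)" "t \<in> range (add_job j)" and eq: "move_job j i s = move_job j i t"
  then obtain s' t' where "s = add_job j s'" "t = add_job j t'" by blast
  with eq show "s = t" using inj_add_job[of i] by (simp add: inj_eq)
qed

text \<open>In the states that are not reached by adding a job at the node, its queue is empty. Hence the
truncating subtraction in \<open>move_job\<close> is harmless.\<close>

lemma (in jackson_network) node_rate_empty_queue:
  assumes "s \<notin> range (add_job i)"
  shows "node_rate i (snd s) = 0"
proof (cases i)
  case None
  have "s = add_job i s" by (simp add: None add_job_def base_vec_def)
  with assms show ?thesis by blast
next
  case (Some j)
  have "snd s $ j = 0"
  proof (rule ccontr)
    assume "snd s $ j \<noteq> 0"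
    then have "snd s = snd s - base_vec i + base_vec i"
      by (auto simp: Some vec_eq_iff base_vec_def axis_def)
    then have "s = add_job i (fst s, snd s - base_vec i)"
      by (simp add: add_job_def prod_eq_iff)
    with assms show False by blast
  qed
  then show ?thesis by (simp add: Some node_rate_def service_0)
qed

section \<open>Breakdowns and repairs\<close>

definition availability_rate :: "('j::finite set \<Rightarrow> real) \<Rightarrow> ('j set \<Rightarrow> real) \<Rightarrow> 'j set \<Rightarrow> 'j set \<Rightarrow> real"
  where "availability_rate A B D H =
    (if H \<subset> D then B D / B H else if D \<subset> H then A H / A D else 0)"

lemma availability_generator_eq:
  "availability_generator A B h D = (\<Sum>H\<in>UNIV. availability_rate A B D H * (h H - h D))"
proof -
  have "(\<Sum>H\<in>UNIV. availability_rate A B D H * (h H - h D))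
      = (\<Sum>H\<in>{H. H \<subset> D} \<union> {H. D \<subset> H}. availability_rate A B D H * (h H - h D))"
    by (rule sum.mono_neutral_right) (auto simp: availability_rate_def)
  also have "\<dots> = (\<Sum>H | H \<subset> D. availability_rate A B D H * (h H - h D))
      + (\<Sum>H | D \<subset> H. availability_rate A B D H * (h H - h D))"
    by (rule sum.union_disjoint) auto
  also have "\<dots> = availability_generator A B h D"
    unfolding availability_generator_def
    by (intro arg_cong2[of _ _ _ _ "(+)"] sum.cong) (auto simp: availability_rate_def)
  finally show ?thesis by simp
qed

context failure_repair
begin

lemma availability_rate_nonneg: "0 \<le> availability_rate A B D H"
  by (simp add: availability_rate_def A_nonneg B_nonneg)

lemma availability_dist_nonneg: "0 \<le> availability_dist A B D"
  by (simp add: availability_dist_def A_nonneg B_nonneg sum_nonneg)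

text \<open>For \<open>D \<subset> I\<close> both sides are \<open>A I / B D\<close> up to normalization. If \<open>A D\<close> or \<open>B I\<close> vanishes then
\<open>A I = 0\<close>, and both sides are zero.\<close>

lemma availability_detailed_balance:
  "availability_dist A B D * availability_rate A B D H
    = availability_dist A B H * availability_rate A B H D"
proof -
  have up: "A D / B D * (A I / A D) = A I / B I * (B I / B D)" if "D \<subset> I" for D I
    using failure_rate_finite[OF that] availability_weight_finite[of I]
    by (cases "A D = 0"; cases "B I = 0") auto
  have "A D / B D * availability_rate A B D H = A H / B H * availability_rate A B H D"
  proof -
    consider "D \<subset> H" | "H \<subset> D" | "\<not> D \<subset> H" "\<not> H \<subset> D" by blast
    then show ?thesis
    proof cases
      case 1
      then have "\<not> H \<subset> D" by blast
      with 1 up[OF 1] show ?thesis by (simp add: availability_rate_def)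
    next
      case 2
      then have "\<not> D \<subset> H" by blast
      with 2 up[OF 2] show ?thesis by (simp add: availability_rate_def)
    qed (simp add: availability_rate_def)
  qed
  then show ?thesis by (simp only: availability_dist_def mult.assoc)
qed

end

section \<open>Routing among the up nodes\<close>

text \<open>Extending the matrices \<open>RD D\<close> by zero makes the index set of the sums independent of the state,
so that sums and integrals can be interchanged.\<close>

definition up_routing :: "('j set \<Rightarrow> 'j routing) \<Rightarrow> 'j option \<Rightarrow> 'j option \<Rightarrow> 'j set \<Rightarrow> real"
  where "up_routing RD j i D = (if j \<in> up_nodes D \<and> i \<in> up_nodes D then RD D j i else 0)"

lemma sum_if_member:
  fixes h :: "'i::finite \<Rightarrow> 'b::comm_monoid_add"
  shows "(\<Sum>i\<in>UNIV. if i \<in> S then h i else 0) = sum h S"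
  using sum.inter_restrict[of UNIV h S] by simp

lemma sum_up_routing_row:
  fixes RD :: "'j::finite set \<Rightarrow> 'j routing"
  shows "(\<Sum>i\<in>UNIV. up_routing RD j i D * h i)
    = (if j \<in> up_nodes D then \<Sum>i\<in>up_nodes D. RD D j i * h i else 0)"
proof -
  have "(\<Sum>i\<in>UNIV. up_routing RD j i D * h i)
      = (\<Sum>i\<in>UNIV. if i \<in> up_nodes D then (if j \<in> up_nodes D then RD D j i * h i else 0) else 0)"
    by (rule sum.cong) (auto simp: up_routing_def)
  also have "\<dots> = (\<Sum>i\<in>up_nodes D. if j \<in> up_nodes D then RD D j i * h i else 0)"
    by (rule sum_if_member)
  finally show ?thesis by auto
qed

lemma sum_up_routing:
  fixes RD :: "'j::finite set \<Rightarrow> 'j routing"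
  shows "(\<Sum>j\<in>UNIV. \<Sum>i\<in>UNIV. up_routing RD j i D * h j i)
    = (\<Sum>j\<in>up_nodes D. \<Sum>i\<in>up_nodes D. RD D j i * h j i)"
  by (simp only: sum_up_routing_row sum_if_member)

context unreliable_jackson_network
begin

section \<open>Integrals with respect to the stationary distribution\<close>

definition weight :: "'j state \<Rightarrow> real"
  where "weight s = availability_dist A B (fst s) * queue_dist \<mu> \<eta> (snd s)"

abbreviation (input) "stationary \<equiv> network_dist \<mu> \<eta> A B"

lemma weight_nonneg: "0 \<le> weight s"
  by (simp add: weight_def availability_dist_nonneg queue_dist_nonneg)

lemma network_dist_eq: "stationary = point_measure UNIV (\<lambda>s. ennreal (weight s))"
  unfolding network_dist_def weight_def case_prod_unfold ..

lemma weight_add_job: "weight (add_job i s) * node_rate i (snd (add_job i s)) = weight s * throughput i"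
  by (simp only: weight_def add_job_def fst_conv snd_conv mult.assoc queue_dist_flow)

text \<open>The substitution of \<open>n + e j\<close> for \<open>n\<close> in the stationary integral. States outside the
range of \<open>add_job j\<close> contribute nothing because the rate of node \<open>j\<close> is zero there.\<close>

lemma departure_to_arrival:
  fixes h :: "'j state \<Rightarrow> real"
  shows integrable_departure_iff_arrival:
      "integrable stationary (\<lambda>s. node_rate j (snd s) * h s)
        \<longleftrightarrow> integrable stationary (\<lambda>s. throughput j * h (add_job j s))" (is ?iff)
    and integral_departure_eq_arrival:
      "(\<integral>s. node_rate j (snd s) * h s \<partial>stationary)
        = (\<integral>s. throughput j * h (add_job j s) \<partial>stationary)" (is ?eq)
proof -
  let ?G = "\<lambda>s. weight s * (node_rate j (snd s) * h s)"
  have comp: "?G \<circ> add_job j = (\<lambda>s. weight s * (throughput j * h (add_job j s)))"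
    by (rule ext) (simp only: o_apply mult.assoc[symmetric] weight_add_job)
  have "?G summable_on UNIV \<longleftrightarrow> ?G summable_on range (add_job j)"
    by (rule summable_on_cong_neutral) (auto simp: node_rate_empty_queue)
  also have "\<dots> \<longleftrightarrow> (?G \<circ> add_job j) summable_on UNIV"
    by (rule summable_on_reindex[OF inj_add_job])
  finally show ?iff
    unfolding network_dist_eq integrable_point_measure_iff_summable_on[of weight, OF weight_nonneg] comp .
  have "infsum ?G UNIV = infsum ?G (range (add_job j))"
    by (rule infsum_cong_neutral) (auto simp: node_rate_empty_queue)
  also have "\<dots> = infsum (?G \<circ> add_job j) UNIV"
    by (rule infsum_reindex[OF inj_add_job])
  finally show ?eq
    unfolding network_dist_eq integral_point_measure_eq_infsum[of weight, OF weight_nonneg] comp .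
qed

lemma up_routing_bounds: "0 \<le> up_routing RD j i D" "up_routing RD j i D \<le> 1"
proof -
  have st: "0 \<le> RD D j i" "RD D j i \<le> 1" if "j \<in> up_nodes D" "i \<in> up_nodes D"
  proof -
    have nn: "0 \<le> RD D j k" if "k \<in> up_nodes D" for k
      using rerouting_stochastic[of D] that \<open>j \<in> up_nodes D\<close> by (simp add: stochastic_on_def)
    then show "0 \<le> RD D j i" using that by simp
    have "RD D j i \<le> (\<Sum>k\<in>up_nodes D. RD D j k)"
      using that nn by (intro member_le_sum) auto
    also have "\<dots> = 1"
      using rerouting_stochastic[of D] that by (simp add: stochastic_on_def)
    finally show "RD D j i \<le> 1" .
  qed
  then show "0 \<le> up_routing RD j i D" "up_routing RD j i D \<le> 1"
    by (auto simp: up_routing_def)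
qed

text \<open>A state \<open>add_job j t\<close> has an outflow from \<open>j\<close> of
\<open>weight t * throughput j\<close>, and the target state \<open>add_job i t\<close> has an outflow from \<open>i\<close> of
\<open>weight t * throughput i\<close>. Comparing the two, with \<open>K\<close> as a bound for the rates, yields the constant
\<open>K * throughput j / throughput i\<close>.\<close>

lemma integrable_move_job:
  assumes f: "f \<in> L2 stationary" and g: "g \<in> L2 stationary"
    and b: "\<And>D. \<bar>b D\<bar> \<le> 1"
  shows "integrable stationary (\<lambda>s. f s * (node_rate j (snd s) * b (fst s) * g (move_job j i s)))"
proof -
  obtain K where K: "\<And>i n. node_rate i n \<le> K" by (rule node_rate_bounded) blast
  have le: "\<bar>node_rate j n * b D\<bar> \<le> node_rate j n" for n D
    using mult_left_mono[OF b node_rate_nonneg] by (simp add: abs_mult node_rate_nonneg)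
  have flow: "weight s * \<bar>node_rate j (snd s) * b (fst s)\<bar>
      \<le> K * throughput j / throughput i * weight (move_job j i s)"
    if s: "s \<in> range (add_job j)" for s
  proof -
    obtain t where t: "s = add_job j t" using s by blast
    have "weight s * \<bar>node_rate j (snd s) * b (fst s)\<bar> \<le> weight s * node_rate j (snd s)"
      by (intro mult_left_mono le weight_nonneg)
    also have "\<dots> = throughput j / throughput i * (weight (add_job i t) * node_rate i (snd (add_job i t)))"
      unfolding t weight_add_job using throughput_pos[of i] by simp
    also have "\<dots> \<le> throughput j / throughput i * (weight (add_job i t) * K)"
      using throughput_pos[of i] throughput_pos[of j]
      by (intro mult_left_mono K weight_nonneg) simp
    finally show ?thesis by (simp add: t mult_ac)
  qed
  show ?thesis
    unfolding network_dist_eq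
  proof (rule integrable_transition[OF weight_nonneg, where T = "move_job j i" and U = "range (add_job j)"
        and C = K and C' = "K * throughput j / throughput i"])
    show "\<bar>node_rate j (snd s) * b (fst s)\<bar> \<le> K" for s
      using le K order_trans by blast
  qed (use f g flow in \<open>simp_all add: network_dist_eq inj_on_move_job node_rate_empty_queue\<close>)
qed

text \<open>The terms \<open>f s * c s * g s\<close> of the generator, in which the state does not change.\<close>

lemma integrable_multiplier:
  assumes f: "f \<in> L2 stationary" and g: "g \<in> L2 stationary"
    and c: "\<And>s. \<bar>c s\<bar> \<le> C"
  shows "integrable stationary (\<lambda>s. f s * (c s * g s))"
  unfolding network_dist_eq
  by (rule integrable_transition[OF weight_nonneg, where T = "\<lambda>s. s" and U = UNIV and C' = C])
     (use f g c in \<open>auto simp: network_dist_eq mult.commute[of C] intro!: mult_left_mono weight_nonneg\<close>)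

text \<open>The start set \<open>D\<close> is fixed so that the transition to \<open>H\<close> is injective; detailed balance
bounds the flow by the rate of the reverse transition.\<close>

lemma integrable_availability_change:
  assumes f: "f \<in> L2 stationary" and g: "g \<in> L2 stationary"
  shows "integrable stationary
    (\<lambda>s. f s * ((if fst s = D then availability_rate A B D H else 0) * g (H, snd s)))"
  unfolding network_dist_eq
proof (rule integrable_transition[OF weight_nonneg, where T = "\<lambda>s. (H, snd s)" and U = "{D} \<times> UNIV"
      and C = "availability_rate A B D H" and C' = "availability_rate A B H D"])
  show "weight s * \<bar>if fst s = D then availability_rate A B D H else 0\<bar>
      \<le> availability_rate A B H D * weight (H, snd s)" if "s \<in> {D} \<times> UNIV" for s
  proof -
    have "weight s * availability_rate A B D H
        = queue_dist \<mu> \<eta> (snd s) * (availability_dist A B D * availability_rate A B D H)"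
      using that by (auto simp: weight_def)
    also have "\<dots> = availability_rate A B H D * weight (H, snd s)"
      unfolding availability_detailed_balance[of D H] by (simp add: weight_def)
    finally show ?thesis
      using that by (auto simp: availability_rate_nonneg)
  qed
qed (use f g in \<open>auto simp: network_dist_eq inj_on_def availability_rate_nonneg\<close>)

section \<open>The generator and the trace\<close>

text \<open>The three kinds of jumps (arrivals, departures, rerouted jobs) are the transitions between up
nodes including node \<open>0\<close>; the added transition from \<open>0\<close> to \<open>0\<close> changes nothing. Summing over the
set \<open>D\<close> as well, with an indicator of the current set, gives summands to which
\<open>integrable_availability_change\<close> applies.\<close>

lemma network_generator_eq:
  "network_generator lam \<mu> A B RD g s
    = (\<Sum>j\<in>UNIV. \<Sum>i\<in>UNIV.
        node_rate j (snd s) * up_routing RD j i (fst s) * (g (move_job j i s) - g s))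
      + (\<Sum>D\<in>UNIV. \<Sum>H\<in>UNIV.
        (if fst s = D then availability_rate A B D H else 0) * (g (H, snd s) - g s))"
proof -
  obtain D n where s: "s = (D, n)" by (cases s)
  let ?d = "\<lambda>j i. node_rate j n * (g (move_job j i s) - g s)"
  have jumps: "(\<Sum>j\<in>UNIV. \<Sum>i\<in>UNIV. node_rate j n * up_routing RD j i D * (g (move_job j i s) - g s))
      = (\<Sum>j\<in>up_nodes D. \<Sum>i\<in>up_nodes D. RD D j i * ?d j i)"
    using sum_up_routing[of RD D ?d] by (simp add: mult_ac)
  have "(\<Sum>D'\<in>UNIV. \<Sum>H\<in>UNIV.
        (if D = D' then availability_rate A B D' H else 0) * (g (H, n) - g s))
      = (\<Sum>D'\<in>UNIV. if D = D' then \<Sum>H\<in>UNIV. availability_rate A B D' H * (g (H, n) - g s) else 0)"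
    by (rule sum.cong) auto
  then have avail: "(\<Sum>D'\<in>UNIV. \<Sum>H\<in>UNIV.
        (if D = D' then availability_rate A B D' H else 0) * (g (H, n) - g s))
      = availability_generator A B (\<lambda>H. g (H, n)) D"
    by (simp add: availability_generator_eq s)
  have stay: "?d None None = 0"
    by (simp add: s move_job_def base_vec_def)
  show ?thesis
    unfolding network_generator_def
    using jumps avail stay
    by (simp add: s sum_up_nodes sum.distrib move_job_def node_rate_def base_vec_def[of None] mult_ac sum_distrib_left)
qed

lemma integrable_generator:
  assumes f: "f \<in> L2 stationary" and g: "g \<in> L2 stationary"
  shows "integrable stationary (\<lambda>s. f s * network_generator lam \<mu> A B RD g s)"
proof -
  obtain K where K: "\<And>i n. node_rate i n \<le> K" by (rule node_rate_bounded) blast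
  have r: "\<bar>up_routing RD j i D\<bar> \<le> 1" for j i D
    using up_routing_bounds by simp
  have c: "\<bar>node_rate j (snd s) * up_routing RD j i (fst s)\<bar> \<le> K" for j i s
    using mult_left_mono[OF r node_rate_nonneg, of j "snd s" j i "fst s"] K[of j "snd s"]
    by (simp add: abs_mult node_rate_nonneg)
  have jump: "integrable stationary (\<lambda>s. f s *
      (node_rate j (snd s) * up_routing RD j i (fst s) * (g (move_job j i s) - g s)))" for j i
    using Bochner_Integration.integrable_diff[OF
        integrable_move_job[OF f g, of "up_routing RD j i" j i, OF r]
        integrable_multiplier[OF f g, of "\<lambda>s. node_rate j (snd s) * up_routing RD j i (fst s)", OF c]]
    by (simp only: right_diff_distrib)
  have avail: "integrable stationary (\<lambda>s. f s *
      ((if fst s = D then availability_rate A B D H else 0) * (g (H, snd s) - g s)))" for D H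
  proof -
    let ?c = "\<lambda>s. if fst s = D then availability_rate A B D H else 0"
    have "\<bar>?c s\<bar> \<le> availability_rate A B D H" for s :: "'j state"
      by (simp add: availability_rate_nonneg)
    then have "integrable stationary (\<lambda>s. f s * (?c s * g s))"
      by (rule integrable_multiplier[OF f g])
    from Bochner_Integration.integrable_diff[OF integrable_availability_change[OF f g, of D H] this]
    show ?thesis by (simp only: right_diff_distrib)
  qed
  show ?thesis
    unfolding network_generator_eq distrib_left sum_distrib_left
    by (intro Bochner_Integration.integrable_add Bochner_Integration.integrable_sum jump avail)
qed

lemma sum_up_routing_row_one:
  "(\<Sum>i\<in>UNIV. up_routing RD j i D) = (if j \<in> up_nodes D then 1 else 0)"
  using sum_up_routing_row[of RD j D "\<lambda>_. 1"] rerouting_stochastic[of D]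
  by (simp add: stochastic_on_def)

text \<open>The factor \<open>lam / routing_dist lam \<eta> D None\<close> is the normalizing constant of the
routing distribution, so it turns the diagonal matrix into that of the throughputs.\<close>

lemma trace_term_eq:
  "trace_term lam \<eta> RD RD' g f s
    = (\<Sum>j\<in>UNIV. \<Sum>i\<in>UNIV. throughput j *
        ((up_routing RD j i (fst s) - up_routing RD' j i (fst s)) * (f (add_job j s) * g (add_job i s))))"
proof -
  obtain D n where s: "s = (D, n)" by (cases s)
  let ?S = "up_nodes D"
  let ?total = "\<Sum>k\<in>?S. throughput k"
  have None: "None \<in> ?S" by (auto simp: up_nodes_def)
  have "?total > 0"
    by (rule sum_pos) (use None throughput_pos in auto)
  then have scale: "lam / routing_dist lam \<eta> D None * routing_dist lam \<eta> D k = throughput k" for k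
    using lam_pos by (simp add: routing_dist_def throughput_def)
  have entry: "mat_mult_on ?S (W_matrix g f D n) (diag_mat (routing_dist lam \<eta> D)) i k
      = W_matrix g f D n i k * routing_dist lam \<eta> D k" if "k \<in> ?S" for i k
    using that by (simp add: mat_mult_on_def diag_mat_def if_distrib cong: if_cong)
  have "trace_term lam \<eta> RD RD' g f s
      = lam / routing_dist lam \<eta> D None *
        (\<Sum>i\<in>?S. \<Sum>k\<in>?S. W_matrix g f D n i k * routing_dist lam \<eta> D k * (RD D k i - RD' D k i))"
    by (simp add: s trace_term_def trace_on_def mat_mult_on_def[of _ "mat_mult_on _ _ _"] entry mat_diff_def)
  also have "\<dots> = (\<Sum>i\<in>?S. \<Sum>k\<in>?S. W_matrix g f D n i k *
      (lam / routing_dist lam \<eta> D None * routing_dist lam \<eta> D k) * (RD D k i - RD' D k i))"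
    by (simp add: sum_distrib_left mult_ac)
  also have "\<dots> = (\<Sum>k\<in>?S. \<Sum>i\<in>?S. (RD D k i - RD' D k i) * (throughput k * (f (add_job k s) * g (add_job i s))))"
    unfolding scale by (subst sum.swap) (simp add: W_matrix_def add_job_def s mult_ac)
  also have "\<dots> = (\<Sum>j\<in>UNIV. \<Sum>i\<in>UNIV. (up_routing RD j i D - up_routing RD' j i D)
      * (throughput j * (f (add_job j s) * g (add_job i s))))"
    unfolding left_diff_distrib sum_subtractf sum_up_routing ..
  finally show ?thesis by (simp add: s mult_ac)
qed

end

theorem theorem3p3:
  fixes lam :: real
    and \<mu> :: "'j::finite \<Rightarrow> nat \<Rightarrow> real"
    and \<eta> :: "'j \<Rightarrow> real"
    and A B :: "'j set \<Rightarrow> real"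
    and R R' :: "'j routing"
    and RD RD' :: "'j set \<Rightarrow> 'j routing"
    and f g :: "'j state \<Rightarrow> real"
  assumes "unreliable_jackson_network lam \<mu> \<eta> A B R RD"
    and "unreliable_jackson_network lam \<mu> \<eta> A B R' RD'"
    and "ergodic_process (network_generator lam \<mu> A B RD)"
    and "f \<in> L2 (network_dist \<mu> \<eta> A B)"
    and "g \<in> L2 (network_dist \<mu> \<eta> A B)"
  shows "integrable (network_dist \<mu> \<eta> A B) (\<lambda>s. f s * network_generator lam \<mu> A B RD g s)
    \<and> integrable (network_dist \<mu> \<eta> A B) (\<lambda>s. f s * network_generator lam \<mu> A B RD' g s)
    \<and> integrable (network_dist \<mu> \<eta> A B) (trace_term lam \<eta> RD RD' g f)
    \<and> L2_inner (network_dist \<mu> \<eta> A B) f (network_generator lam \<mu> A B RD g)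
        - L2_inner (network_dist \<mu> \<eta> A B) f (network_generator lam \<mu> A B RD' g)
      = (\<integral>s. trace_term lam \<eta> RD RD' g f s \<partial>network_dist \<mu> \<eta> A B)"
proof -
  interpret N: unreliable_jackson_network lam \<mu> \<eta> A B R RD by (rule assms(1))
  interpret N': unreliable_jackson_network lam \<mu> \<eta> A B R' RD' by (rule assms(2))
  note f = assms(4) and g = assms(5)
  let ?M = "network_dist \<mu> \<eta> A B"
  let ?Q = "network_generator lam \<mu> A B RD g" and ?Q' = "network_generator lam \<mu> A B RD' g"
  let ?d = "\<lambda>j i D. up_routing RD j i D - up_routing RD' j i D"
  let ?h = "\<lambda>j i s. ?d j i (fst s) * (f s * g (move_job j i s))"
  have int: "integrable ?M (\<lambda>s. f s * ?Q s)" and int': "integrable ?M (\<lambda>s. f s * ?Q' s)"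
    using N.integrable_generator[OF f g] N'.integrable_generator[OF f g] by simp_all
  have "\<bar>?d j i D\<bar> \<le> 1" for j i D
    using N.up_routing_bounds[of j i D] N'.up_routing_bounds[of j i D] by linarith
  then have dep: "integrable ?M (\<lambda>s. N.node_rate j (snd s) * ?h j i s)" for j i
    using N.integrable_move_job[OF f g, of "?d j i" j i] by (simp add: mult_ac)
  then have arr: "integrable ?M (\<lambda>s. N.throughput j * ?h j i (add_job j s))" for j i
    by (subst N.integrable_departure_iff_arrival[symmetric])
  have trace: "trace_term lam \<eta> RD RD' g f s
      = (\<Sum>j\<in>UNIV. \<Sum>i\<in>UNIV. N.throughput j * ?h j i (add_job j s))" for s
    by (simp add: N.trace_term_eq add_job_def[of _ s]) (simp add: add_job_def move_job_def)
  (* The terms with g s cancel, because the rows of both routing matrices have the same sum. *)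
  have diff: "f s * ?Q s - f s * ?Q' s
      = (\<Sum>j\<in>UNIV. \<Sum>i\<in>UNIV. N.node_rate j (snd s) * ?h j i s)" for s
  proof -
    have row: "(\<Sum>i\<in>UNIV. ?d j i (fst s)) = 0" for j
      by (simp add: sum_subtractf N.sum_up_routing_row_one N'.sum_up_routing_row_one)
    have "?Q s - ?Q' s = (\<Sum>j\<in>UNIV. \<Sum>i\<in>UNIV. N.node_rate j (snd s) * ?d j i (fst s) * (g (move_job j i s) - g s))"
      by (simp add: N.network_generator_eq N'.network_generator_eq
          right_diff_distrib left_diff_distrib sum_subtractf)
    also have "\<dots> = (\<Sum>j\<in>UNIV. (\<Sum>i\<in>UNIV. N.node_rate j (snd s) * ?d j i (fst s) * g (move_job j i s))
        - N.node_rate j (snd s) * g s * (\<Sum>i\<in>UNIV. ?d j i (fst s)))"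
      unfolding sum_distrib_left sum_subtractf[symmetric] by (simp add: algebra_simps)
    finally have "?Q s - ?Q' s = (\<Sum>j\<in>UNIV. \<Sum>i\<in>UNIV. N.node_rate j (snd s) * ?d j i (fst s) * g (move_job j i s))"
      by (simp only: row mult_zero_right diff_zero)
    then show ?thesis
      unfolding right_diff_distrib[symmetric] by (simp add: sum_distrib_left mult_ac)
  qed
  have "L2_inner ?M f ?Q - L2_inner ?M f ?Q' = (\<integral>s. f s * ?Q s - f s * ?Q' s \<partial>?M)"
    unfolding L2_inner_def using int int' by simp
  also have "\<dots> = (\<Sum>j\<in>UNIV. \<Sum>i\<in>UNIV. \<integral>s. N.node_rate j (snd s) * ?h j i s \<partial>?M)"
    unfolding diff using dep by (simp add: Bochner_Integration.integral_sum)
  also have "\<dots> = (\<Sum>j\<in>UNIV. \<Sum>i\<in>UNIV. \<integral>s. N.throughput j * ?h j i (add_job j s) \<partial>?M)"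
    by (simp only: N.integral_departure_eq_arrival)
  also have "\<dots> = (\<integral>s. trace_term lam \<eta> RD RD' g f s \<partial>?M)"
    unfolding trace using arr by (simp add: Bochner_Integration.integral_sum)
  finally have eq: "L2_inner ?M f ?Q - L2_inner ?M f ?Q' = (\<integral>s. trace_term lam \<eta> RD RD' g f s \<partial>?M)" .
  have "integrable ?M (trace_term lam \<eta> RD RD' g f)"
    unfolding trace[abs_def] using arr by (intro Bochner_Integration.integrable_sum)
  with int int' eq show ?thesis by blast
qed

end
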